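(* For any path $P_n$ of order $n\ge 4$, $\gamma_{tc}(M(P_n))=2n-4$.
   Context: All graphs are finite, simple and undirected. For a graph $H$, a set $D\subseteq V(H)$ is a total dominating set if every vertex of $H$ has a neighbor in $D$. A set $D\subseteq V(H)$ is a total outer-connected dominating set of $H$ if $D$ is a total dominating set and the induced subgraph $H[V(H)\setminus D]$ is connected; $\gamma_{tc}(H)$ denotes the minimum cardinality of a total outer-connected dominating set of $H$. The middle graph $M(G)$ of a graph $G$ has vertex set $V(G)\cup E(G)$, where two elements $x,y$ are adjacent iff either $x,y\in E(G)$ are edges of $G$ sharing an endpoint, or one of them is a vertex of $G$ and the other is an edge of $G$ incident to it. *)

theory Defs
  imports "Graph_Theory.Graph_Theory"
begin

text \<open>
  A finite simple undirected graph is a \<^locale>\<open>pair_graph\<close>: a finite, loop-free, symmetric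
  digraph whose arcs are vertex pairs. Its undirected edge \<open>{u, v}\<close> is represented by the two
  arcs \<open>(u, v)\<close> and \<open>(v, u)\<close>.
\<close>

definition uedges :: "'a pair_pre_digraph \<Rightarrow> 'a set set" where
  "uedges G = {{u, v} | u v. (u, v) \<in> parcs G}"

definition middle_graph :: "'a pair_pre_digraph \<Rightarrow> ('a + 'a set) pair_pre_digraph" where
  "middle_graph G =
    \<lparr> pverts = Inl ` pverts G \<union> Inr ` uedges G,
      parcs = {(Inr e, Inr f) | e f. e \<in> uedges G \<and> f \<in> uedges G \<and> e \<noteq> f \<and> e \<inter> f \<noteq> {}}
        \<union> {(Inl v, Inr e) | v e. v \<in> pverts G \<and> e \<in> uedges G \<and> v \<in> e}
        \<union> {(Inr e, Inl v) | v e. v \<in> pverts G \<and> e \<in> uedges G \<and> v \<in> e} \<rparr>"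

definition total_dominating_set :: "'a pair_pre_digraph \<Rightarrow> 'a set \<Rightarrow> bool" where
  "total_dominating_set H D \<longleftrightarrow>
    D \<subseteq> pverts H \<and> (\<forall>v \<in> pverts H. \<exists>u \<in> D. (v, u) \<in> parcs H)"

text \<open>
  The library's connectedness excludes the graph without vertices, so \<open>D = pverts H\<close> is not a
  total outer-connected dominating set. The qualified name avoids the topological notion.
\<close>

definition total_outer_connected_dominating_set :: "'a pair_pre_digraph \<Rightarrow> 'a set \<Rightarrow> bool" where
  "total_outer_connected_dominating_set H D \<longleftrightarrow>
    total_dominating_set H D \<and> Digraph_Component.connected (with_proj H \<restriction> (pverts H - D))"

definition gamma_tc :: "'a pair_pre_digraph \<Rightarrow> nat" where
  "gamma_tc H = (LEAST k. \<exists>D. total_outer_connected_dominating_set H D \<and> card D = k)"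

definition path_graph :: "nat \<Rightarrow> 'a pair_pre_digraph \<Rightarrow> bool" where
  "path_graph n G \<longleftrightarrow>
    (\<exists>xs. distinct xs \<and> length xs = n \<and> pverts G = set xs \<and>
      parcs G = {(xs ! i, xs ! j) | i j. i < n \<and> j < n \<and> (j = Suc i \<or> i = Suc j)})"

lemma path_graph_imp_pair_graph:
  assumes "path_graph n G"
  shows "pair_graph G"
proof -
  obtain xs where xs: "distinct xs" "length xs = n" "pverts G = set xs"
    and arcs: "parcs G = {(xs ! i, xs ! j) | i j. i < n \<and> j < n \<and> (j = Suc i \<or> i = Suc j)}"
    using assms unfolding path_graph_def by blast
  have sub: "parcs G \<subseteq> set xs \<times> set xs"
    using xs(2) unfolding arcs by auto
  have "finite (parcs G)"
    by (rule finite_subset[OF sub]) simp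
  moreover have "sym (parcs G)"
    unfolding arcs sym_def by blast
  moreover have "fst e \<noteq> snd e" if "e \<in> parcs G" for e
    using that xs(1,2) unfolding arcs by (auto simp: nth_eq_iff_index_eq)
  ultimately show ?thesis
    using sub xs(3) by unfold_locales (auto simp: symmetric_def)
qed

lemma pair_graph_middle_graph:
  assumes "pair_graph G"
  shows "pair_graph (middle_graph G)"
proof -
  interpret pair_graph G by fact
  have "uedges G \<subseteq> (\<lambda>(u, v). {u, v}) ` parcs G"
    by (auto simp: uedges_def)
  then have fin: "finite (uedges G)"
    by (rule finite_subset) simp
  have finv: "finite (pverts (middle_graph G))"
    using fin pair_finite_verts by (simp add: middle_graph_def)
  have sub: "parcs (middle_graph G) \<subseteq> pverts (middle_graph G) \<times> pverts (middle_graph G)"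
    by (auto simp: middle_graph_def)
  have "finite (parcs (middle_graph G))"
    by (rule finite_subset[OF sub]) (simp add: finv)
  moreover have "sym (parcs (middle_graph G))"
    by (auto simp: middle_graph_def sym_def)
  moreover have "fst e \<noteq> snd e" if "e \<in> parcs (middle_graph G)" for e
    using that by (auto simp: middle_graph_def)
  ultimately show ?thesis
    using sub finv by unfold_locales (auto simp: symmetric_def)
qed

end

theory Submission
  imports Defs
begin

text \<open>
  Let \<open>C\<close> be the complement of a total outer-connected dominating set \<open>D\<close> of \<open>M(G)\<close>. A vertex of
  \<open>G\<close> is adjacent in \<open>M(G)\<close> only to its incident edges, so one of these lies in \<open>D\<close>. If every
  vertex is incident to at most two edges, then the edges in \<open>C\<close> are pairwise disjoint, and an edge
  in \<open>C\<close> together with its two ends is closed under adjacency within \<open>C\<close>. As \<open>C\<close> is connected, it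
  consists of at most one edge and its ends, whence \<open>|D| \<ge> |V(G)| + |E(G)| - 3\<close>. Conversely, an edge
  \<open>e\<close> and its ends form the complement of a total outer-connected dominating set as soon as every
  vertex is incident to an edge other than \<open>e\<close>; in \<open>P\<^sub>n\<close> with \<open>n \<ge> 4\<close> the second edge is of this
  kind.
\<close>

lemma connected_verts_subset_closed:
  assumes conn: "Digraph_Component.connected H"
    and x: "x \<in> verts H" "x \<in> S"
    and closed: "\<And>u v. u \<rightarrow>\<^bsub>H\<^esub> v \<Longrightarrow> u \<in> S \<longleftrightarrow> v \<in> S"
  shows "verts H \<subseteq> S"
proof
  fix y assume "y \<in> verts H"
  with conn x(1) have "(x, y) \<in> rtrancl_on (verts H) (parcs (mk_symmetric H))"
    by (auto simp: Digraph_Component.connected_def strongly_connected_def reachable_def)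
  then show "y \<in> S"
  proof (induction rule: rtrancl_on_induct)
    case base
    show ?case by (rule x(2))
  next
    case (step y z)
    then have "y \<rightarrow>\<^bsub>H\<^esub> z \<or> z \<rightarrow>\<^bsub>H\<^esub> y"
      by (auto simp: parcs_mk_symmetric arcs_ends_conv)
    with step.IH closed show ?case by blast
  qed
qed

lemma connected_if_center_dominates:
  assumes x: "x \<in> verts H" and center: "\<And>y. \<lbrakk>y \<in> verts H; y \<noteq> x\<rbrakk> \<Longrightarrow> x \<rightarrow>\<^bsub>H\<^esub> y"
  shows "Digraph_Component.connected H"
proof -
  let ?R = "rtrancl_on (verts H) (parcs (mk_symmetric H))"
  have from_center: "(x, y) \<in> ?R" if y: "y \<in> verts H" for y
  proof (cases "y = x")
    case False
    with center y have "(x, y) \<in> parcs (mk_symmetric H)"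
      by (fastforce simp: parcs_mk_symmetric)
    with x y show ?thesis by (blast intro: rtrancl_on_into_rtrancl_on)
  qed (use x in simp)
  have "sym ?R"
    using symmetric_mk_symmetric[of H] by (simp add: symmetric_def rtrancl_on_sym)
  with from_center have "(y, z) \<in> ?R" if "y \<in> verts H" "z \<in> verts H" for y z
    using that by (blast intro: rtrancl_on_trans dest: symD)
  with x show ?thesis
    by (auto simp: Digraph_Component.connected_def strongly_connected_def reachable_def)
qed

lemma gamma_tc_eqI:
  assumes "total_outer_connected_dominating_set H D"
    and "\<And>D'. total_outer_connected_dominating_set H D' \<Longrightarrow> card D \<le> card D'"
  shows "gamma_tc H = card D"
  unfolding gamma_tc_def by (rule Least_equality) (use assms in auto)

lemma pverts_middle_graph: "pverts (middle_graph G) = pverts G <+> uedges G"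
  by (simp add: middle_graph_def Plus_def)

lemma middle_graph_arc_iff [simp]:
  "(Inl u, Inl v) \<notin> parcs (middle_graph G)"
  "(Inl v, Inr e) \<in> parcs (middle_graph G) \<longleftrightarrow> v \<in> pverts G \<and> e \<in> uedges G \<and> v \<in> e"
  "(Inr e, Inl v) \<in> parcs (middle_graph G) \<longleftrightarrow> v \<in> pverts G \<and> e \<in> uedges G \<and> v \<in> e"
  "(Inr e, Inr f) \<in> parcs (middle_graph G) \<longleftrightarrow>
    e \<in> uedges G \<and> f \<in> uedges G \<and> e \<noteq> f \<and> e \<inter> f \<noteq> {}"
  by (auto simp: middle_graph_def)

definition incident_edges :: "'a pair_pre_digraph \<Rightarrow> 'a \<Rightarrow> 'a set set" where
  "incident_edges G v = {e \<in> uedges G. v \<in> e}"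

definition edge_star :: "'a set \<Rightarrow> ('a + 'a set) set" where
  "edge_star e = e <+> {e}"

context pair_graph
begin

lemma uedges_subset_Pow: "uedges G \<subseteq> Pow (pverts G)"
  by (auto simp: uedges_def dest: in_arcsD1 in_arcsD2)

lemma finite_uedges: "finite (uedges G)"
  by (rule finite_subset[OF uedges_subset_Pow]) simp

lemma finite_uedge: "e \<in> uedges G \<Longrightarrow> finite e"
  by (auto simp: uedges_def)

lemma card_uedge: "e \<in> uedges G \<Longrightarrow> card e = 2"
  by (auto simp: uedges_def dest: no_loops')

lemma uedge_subset_imp_eq: "\<lbrakk>e \<in> uedges G; f \<in> uedges G; f \<subseteq> e\<rbrakk> \<Longrightarrow> f = e"
  by (rule card_subset_eq) (simp_all add: finite_uedge card_uedge)

lemma finite_pverts_middle_graph: "finite (pverts (middle_graph G))"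
  by (simp add: pverts_middle_graph finite_uedges)

lemma card_pverts_middle_graph:
  "card (pverts (middle_graph G)) = card (pverts G) + card (uedges G)"
  by (simp add: pverts_middle_graph card_Plus finite_uedges)

lemma edge_star_subset_pverts: "e \<in> uedges G \<Longrightarrow> edge_star e \<subseteq> pverts (middle_graph G)"
  using uedges_subset_Pow by (auto simp: edge_star_def pverts_middle_graph)

lemma finite_edge_star: "e \<in> uedges G \<Longrightarrow> finite (edge_star e)"
  by (simp add: edge_star_def finite_uedge)

lemma card_edge_star: "e \<in> uedges G \<Longrightarrow> card (edge_star e) = 3"
  by (simp add: edge_star_def card_Plus finite_uedge card_uedge)

lemma total_dominating_set_outside_edges_disjnt:
  assumes tds: "total_dominating_set (middle_graph G) D"
    and degree: "\<And>v. v \<in> pverts G \<Longrightarrow> card (incident_edges G v) \<le> 2"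
  shows "pairwise disjnt {e \<in> uedges G. Inr e \<notin> D}"
proof (rule pairwiseI)
  fix e f assume ef: "e \<in> {e \<in> uedges G. Inr e \<notin> D}" "f \<in> {e \<in> uedges G. Inr e \<notin> D}" "e \<noteq> f"
  show "disjnt e f"
  proof (rule ccontr)
    assume "\<not> disjnt e f"
    then obtain v where v: "v \<in> e" "v \<in> f" by (auto simp: disjnt_def)
    with ef uedges_subset_Pow have "v \<in> pverts G" by blast
    with tds obtain x where "x \<in> D" "(Inl v, x) \<in> parcs (middle_graph G)"
      by (auto simp: total_dominating_set_def pverts_middle_graph)
    then obtain g where g: "Inr g \<in> D" "g \<in> incident_edges G v"
      by (cases x) (auto simp: incident_edges_def)
    have "card {e, f, g} \<le> card (incident_edges G v)"
      using ef v g(2) finite_uedges by (intro card_mono) (auto simp: incident_edges_def)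
    moreover have "card {e, f, g} = 3"
      using ef g(1) by (auto simp: card_insert_if)
    ultimately show False
      using degree[OF \<open>v \<in> pverts G\<close>] by simp
  qed
qed

lemma connected_disjnt_edges_subset_edge_star:
  assumes conn: "Digraph_Component.connected (with_proj (middle_graph G) \<restriction> C)"
    and disjnt: "pairwise disjnt {f. Inr f \<in> C}"
    and e: "Inr e \<in> C"
  shows "C \<subseteq> edge_star e"
proof -
  have same_edge: "f = g" if "Inr f \<in> C" "Inr g \<in> C" "v \<in> f" "v \<in> g" for f g v
    using that pairwiseD[OF disjnt, of f g] by (auto simp: disjnt_def)
  have "x \<in> edge_star e \<longleftrightarrow> y \<in> edge_star e"
    if "x \<rightarrow>\<^bsub>with_proj (middle_graph G) \<restriction> C\<^esub> y" for x y
  proof -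
    from that have "x \<in> C" "y \<in> C" "(x, y) \<in> parcs (middle_graph G)"
      by (auto simp: arcs_ends_conv)
    then show ?thesis
      using e by (cases x; cases y) (auto simp: edge_star_def dest: same_edge)
  qed
  moreover have "Inr e \<in> edge_star e"
    by (auto simp: edge_star_def)
  ultimately show ?thesis
    using connected_verts_subset_closed[OF conn, of "Inr e" "edge_star e"] e by simp
qed

lemma connected_no_edges_singleton:
  assumes conn: "Digraph_Component.connected (with_proj (middle_graph G) \<restriction> C)"
    and no_edge: "\<And>e. Inr e \<notin> C"
  obtains x where "C = {x}"
proof -
  from conn obtain x where x: "x \<in> C"
    by (auto simp: Digraph_Component.connected_def strongly_connected_def)
  have "\<not> y \<rightarrow>\<^bsub>with_proj (middle_graph G) \<restriction> C\<^esub> z" for y z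
    using no_edge by (cases y; cases z) (auto simp: arcs_ends_conv)
  then have "C \<subseteq> {x}"
    using connected_verts_subset_closed[OF conn, of x "{x}"] x by simp
  with x that show ?thesis by blast
qed

lemma card_connected_disjnt_edges_le_3:
  assumes C: "C \<subseteq> pverts (middle_graph G)"
    and conn: "Digraph_Component.connected (with_proj (middle_graph G) \<restriction> C)"
    and disjnt: "pairwise disjnt {e. Inr e \<in> C}"
  shows "card C \<le> 3"
proof (cases "\<exists>e. Inr e \<in> C")
  case True
  then obtain e where "Inr e \<in> C" "e \<in> uedges G"
    using C by (auto simp: pverts_middle_graph)
  then show ?thesis
    using card_mono[OF finite_edge_star connected_disjnt_edges_subset_edge_star[OF conn disjnt]]
    by (simp add: card_edge_star)
next
  case False
  with conn obtain x where "C = {x}"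
    by (blast elim: connected_no_edges_singleton)
  then show ?thesis by simp
qed

lemma card_total_outer_connected_dominating_set_ge:
  assumes D: "total_outer_connected_dominating_set (middle_graph G) D"
    and degree: "\<And>v. v \<in> pverts G \<Longrightarrow> card (incident_edges G v) \<le> 2"
  shows "card (pverts G) + card (uedges G) - 3 \<le> card D"
proof -
  let ?V = "pverts (middle_graph G)"
  have tds: "total_dominating_set (middle_graph G) D"
    and conn: "Digraph_Component.connected (with_proj (middle_graph G) \<restriction> (?V - D))"
    using D by (simp_all add: total_outer_connected_dominating_set_def)
  have "{e. Inr e \<in> ?V - D} = {e \<in> uedges G. Inr e \<notin> D}"
    by (auto simp: pverts_middle_graph)
  then have "pairwise disjnt {e. Inr e \<in> ?V - D}"
    using total_dominating_set_outside_edges_disjnt[OF tds degree] by simp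
  then have "card (?V - D) \<le> 3"
    using card_connected_disjnt_edges_le_3[OF _ conn] by blast
  moreover have "D \<subseteq> ?V"
    using tds by (simp add: total_dominating_set_def)
  then have "card (?V - D) = card ?V - card D"
    by (intro card_Diff_subset) (auto intro: finite_subset finite_pverts_middle_graph)
  ultimately show ?thesis by (simp add: card_pverts_middle_graph)
qed

lemma connected_edge_star:
  assumes "e \<in> uedges G"
  shows "Digraph_Component.connected (with_proj (middle_graph G) \<restriction> edge_star e)"
proof (rule connected_if_center_dominates)
  show "Inr e \<in> verts (with_proj (middle_graph G) \<restriction> edge_star e)"
    by (auto simp: edge_star_def)
next
  fix y assume "y \<in> verts (with_proj (middle_graph G) \<restriction> edge_star e)" "y \<noteq> Inr e"
  then obtain v where "y = Inl v" "v \<in> e"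
    by (auto simp: edge_star_def)
  with assms uedges_subset_Pow
  show "Inr e \<rightarrow>\<^bsub>with_proj (middle_graph G) \<restriction> edge_star e\<^esub> y"
    by (auto simp: edge_star_def arcs_ends_conv)
qed

lemma total_dominating_set_Diff_edge_star:
  assumes e: "e \<in> uedges G"
    and other_edge: "\<And>v. v \<in> pverts G \<Longrightarrow> \<not> incident_edges G v \<subseteq> {e}"
  shows "total_dominating_set (middle_graph G) (pverts (middle_graph G) - edge_star e)"
    (is "total_dominating_set _ ?D")
proof -
  have outside_edge: "\<exists>f. Inr f \<in> ?D \<and> f \<in> uedges G \<and> f \<noteq> e \<and> v \<in> f" if "v \<in> pverts G" for v
    using other_edge[OF that] by (auto simp: incident_edges_def edge_star_def pverts_middle_graph)
  have "\<exists>y \<in> ?D. (x, y) \<in> parcs (middle_graph G)" if "x \<in> pverts (middle_graph G)" for x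
  proof -
    from that consider (vertex) v where "x = Inl v" "v \<in> pverts G"
      | (center) "x = Inr e"
      | (edge) f where "x = Inr f" "f \<in> uedges G" "f \<noteq> e"
      by (auto simp: pverts_middle_graph)
    then show ?thesis
    proof cases
      case vertex
      then obtain f where "Inr f \<in> ?D" "f \<in> uedges G" "v \<in> f"
        using outside_edge by blast
      with vertex show ?thesis
        by (intro bexI[of _ "Inr f"]) simp_all
    next
      case center
      obtain v where v: "v \<in> e" "v \<in> pverts G"
        using e by (auto simp: uedges_def dest: in_arcsD1)
      then obtain f where "Inr f \<in> ?D" "f \<in> uedges G" "f \<noteq> e" "v \<in> f"
        using outside_edge by blast
      with center e v(1) show ?thesis
        by (intro bexI[of _ "Inr f"]) auto
    next
      case edge
      then have "\<not> f \<subseteq> e"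
        using e uedge_subset_imp_eq by blast
      then obtain v where "v \<in> f" "v \<notin> e" by blast
      with edge uedges_subset_Pow show ?thesis
        by (intro bexI[of _ "Inl v"]) (auto simp: edge_star_def pverts_middle_graph)
    qed
  qed
  then show ?thesis by (simp add: total_dominating_set_def)
qed

theorem gamma_tc_middle_graph_max_degree_2:
  assumes degree: "\<And>v. v \<in> pverts G \<Longrightarrow> card (incident_edges G v) \<le> 2"
    and e: "e \<in> uedges G"
    and other_edge: "\<And>v. v \<in> pverts G \<Longrightarrow> \<not> incident_edges G v \<subseteq> {e}"
  shows "gamma_tc (middle_graph G) = card (pverts G) + card (uedges G) - 3"
proof -
  let ?D = "pverts (middle_graph G) - edge_star e"
  have "card ?D = card (pverts G) + card (uedges G) - 3"
    using e by (simp add: card_Diff_subset finite_edge_star edge_star_subset_pverts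
        card_edge_star card_pverts_middle_graph)
  moreover have "total_outer_connected_dominating_set (middle_graph G) ?D"
    using e total_dominating_set_Diff_edge_star[OF e other_edge]
    by (simp add: total_outer_connected_dominating_set_def double_diff edge_star_subset_pverts
        connected_edge_star)
  ultimately show ?thesis
    using gamma_tc_eqI card_total_outer_connected_dominating_set_ge degree by metis
qed

end

definition path_edge :: "(nat \<Rightarrow> 'a) \<Rightarrow> nat \<Rightarrow> 'a set" where
  "path_edge p i = {p i, p (Suc i)}"

lemma path_graphE:
  assumes "path_graph n G"
  obtains p where "inj_on p {..<n}" "pverts G = p ` {..<n}" "uedges G = path_edge p ` {..<n - 1}"
proof -
  from assms obtain xs where xs: "distinct xs" "length xs = n" "pverts G = set xs"
    and arcs: "parcs G = {(xs ! i, xs ! j) | i j. i < n \<and> j < n \<and> (j = Suc i \<or> i = Suc j)}"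
    unfolding path_graph_def by blast
  have "inj_on ((!) xs) {..<n}"
    using xs by (simp add: inj_on_nth)
  moreover have "pverts G = (!) xs ` {..<n}"
    using xs(2,3) by (auto simp: set_conv_nth)
  moreover have "uedges G = path_edge ((!) xs) ` {..<n - 1}"
  proof (intro equalityI subsetI)
    fix e assume "e \<in> uedges G"
    then show "e \<in> path_edge ((!) xs) ` {..<n - 1}"
      by (auto simp: uedges_def arcs path_edge_def insert_commute)
  next
    fix e assume "e \<in> path_edge ((!) xs) ` {..<n - 1}"
    then obtain i where "e = {xs ! i, xs ! Suc i}" "Suc i < n"
      by (auto simp: path_edge_def)
    moreover from this have "(xs ! i, xs ! Suc i) \<in> parcs G"
      by (force simp: arcs)
    ultimately show "e \<in> uedges G"
      by (auto simp: uedges_def)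
  qed
  ultimately show ?thesis by (rule that)
qed

lemma mem_path_edge_iff:
  assumes "inj_on p {..<n}" "i < n" "Suc j < n"
  shows "p i \<in> path_edge p j \<longleftrightarrow> i = j \<or> i = Suc j"
  using assms by (auto simp: path_edge_def inj_on_eq_iff)

lemma inj_on_path_edge:
  assumes "inj_on p {..<n}"
  shows "inj_on (path_edge p) {..<n - 1}"
  by (auto simp: inj_on_def path_edge_def doubleton_eq_iff inj_on_eq_iff[OF assms])

lemma card_pverts_path_graph: "path_graph n G \<Longrightarrow> card (pverts G) = n"
  by (erule path_graphE) (simp add: card_image)

lemma card_uedges_path_graph: "path_graph n G \<Longrightarrow> card (uedges G) = n - 1"
  by (erule path_graphE) (metis card_image card_lessThan inj_on_path_edge)

lemma card_incident_edges_path_graph_le_2: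
  assumes "path_graph n G" "v \<in> pverts G"
  shows "card (incident_edges G v) \<le> 2"
proof -
  from assms(1) obtain p where p: "inj_on p {..<n}" "pverts G = p ` {..<n}"
    and edges: "uedges G = path_edge p ` {..<n - 1}"
    by (rule path_graphE)
  from assms(2) p(2) obtain i where i: "v = p i" "i < n" by blast
  have "incident_edges G v \<subseteq> {path_edge p (i - 1), path_edge p i}"
    using i by (auto simp: incident_edges_def edges mem_path_edge_iff[OF p(1)])
  then have "card (incident_edges G v) \<le> card {path_edge p (i - 1), path_edge p i}"
    by (intro card_mono) simp_all
  also have "\<dots> \<le> 2" by (simp add: card_insert_if)
  finally show ?thesis .
qed

lemma path_graph_edge_not_sole_incidentE:
  assumes "n \<ge> 4" "path_graph n G"
  obtains e where "e \<in> uedges G" "\<And>v. v \<in> pverts G \<Longrightarrow> \<not> incident_edges G v \<subseteq> {e}"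
proof -
  from assms(2) obtain p where p: "inj_on p {..<n}" "pverts G = p ` {..<n}"
    and edges: "uedges G = path_edge p ` {..<n - 1}"
    by (rule path_graphE)
  have "\<not> incident_edges G v \<subseteq> {path_edge p 1}" if v: "v \<in> pverts G" for v
  proof -
    from v p(2) obtain i where i: "v = p i" "i < n" by blast
    define j where "j = (if i \<le> 1 then 0 else if i = 2 then 2 else i - 1)"
    have j: "Suc j < n" "j \<noteq> 1" "i = j \<or> i = Suc j"
      using assms(1) i(2) by (auto simp: j_def)
    have "path_edge p j \<in> incident_edges G v"
      using i j by (auto simp: incident_edges_def edges mem_path_edge_iff[OF p(1)])
    moreover have "path_edge p j \<noteq> path_edge p 1"
      using assms(1) j by (simp add: inj_on_eq_iff[OF inj_on_path_edge[OF p(1)]])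
    ultimately show ?thesis by blast
  qed
  moreover have "path_edge p 1 \<in> uedges G"
    using assms(1) by (simp add: edges)
  ultimately show ?thesis using that by blast
qed

theorem theorem3p7:
  fixes G :: "'a pair_pre_digraph" and n :: nat
  assumes "n \<ge> 4" and "path_graph n G"
  shows "gamma_tc (middle_graph G) = 2 * n - 4"
proof -
  interpret pair_graph G
    using assms(2) by (rule path_graph_imp_pair_graph)
  obtain e where "e \<in> uedges G" "\<And>v. v \<in> pverts G \<Longrightarrow> \<not> incident_edges G v \<subseteq> {e}"
    using path_graph_edge_not_sole_incidentE[OF assms] by blast
  then have "gamma_tc (middle_graph G) = card (pverts G) + card (uedges G) - 3"
    by (intro gamma_tc_middle_graph_max_degree_2 card_incident_edges_path_graph_le_2[OF assms(2)])
  also have "\<dots> = 2 * n - 4"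
    by (simp add: card_pverts_path_graph[OF assms(2)] card_uedges_path_graph[OF assms(2)])
  finally show ?thesis .
qed

end
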